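(* Let $A\in\mathbb{R}^{m\times n}$, $\nu>0$, and let $h:\mathbb{R}^m\to\mathbb{R}$ be $\alpha$-strongly convex with $\alpha>0$. Let $P_A=A(A^\top A)^\dagger A^\top$ and $$p_\nu(w)=h(w)+\frac{1}{2\nu}\|(I-P_A)w\|^2 ,$$ and let $w^*$ be the minimizer of $p_\nu$. Then for any $w^0\in\mathbb{R}^m$, the iterates $w^{k+1}=\mathrm{prox}_{\nu h}(P_Aw^k)$, $k\ge0$, satisfy $$\|w^{k+1}-w^*\|^2\le\frac{1}{1+\alpha\nu}\|w^k-w^*\|^2\qquad\text{for all }k\ge0.$$
   Context: $\|\cdot\|$ is the Euclidean norm and $\dagger$ the pseudo-inverse, so $P_A$ is the orthogonal projector onto the range of $A$. $\mathrm{prox}_{\nu h}(y)=\operatorname{argmin}_w\{h(w)+\frac{1}{2\nu}\|w-y\|^2\}$. $\alpha$-strong convexity means $h-\frac{\alpha}{2}\|\cdot\|^2$ is convex. Standing assumptions: $h$ is closed and proper, and separable, $h(w)=\sum_{i=1}^m h_i(w_i)$. The iteration is the proximal gradient method $w^{k+1}=\mathrm{prox}_{\nu h}(w^k-\nu\nabla g_\nu(w^k))$ for minimizing $h+g_\nu$, where $g_\nu(w)=\min_x\{g(x)+\frac1{2\nu}\|Ax-w\|^2\}$ with $g=0$, so that $g_\nu(w)=\frac1{2\nu}\|(I-P_A)w\|^2$ and $w-\nu\nabla g_\nu(w)=P_Aw$. *)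

theory Defs
  imports "HOL-Analysis.Analysis"
begin

definition strongly_convex :: "real \<Rightarrow> ('a::real_normed_vector \<Rightarrow> real) \<Rightarrow> bool" where
  "strongly_convex \<alpha> h \<longleftrightarrow> convex_on UNIV (\<lambda>w. h w - \<alpha> / 2 * (norm w)\<^sup>2)"

(* Moore-Penrose pseudo-inverse: the unique solution of the four Penrose equations. *)
definition pinv :: "real ^ 'n ^ 'm \<Rightarrow> real ^ 'm ^ 'n" where
  "pinv M = (THE X. M ** X ** M = M \<and> X ** M ** X = X
     \<and> transpose (M ** X) = M ** X \<and> transpose (X ** M) = X ** M)"

definition range_proj :: "real ^ 'n ^ 'm \<Rightarrow> real ^ 'm ^ 'm" where
  "range_proj A = A ** pinv (transpose A ** A) ** transpose A"

(* The minimizer is unique when h is strongly convex and \<nu> > 0; in general the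
   definition picks some minimizer, and is unspecified if there is none. *)
definition prox :: "real \<Rightarrow> ('a::real_normed_vector \<Rightarrow> real) \<Rightarrow> 'a \<Rightarrow> 'a" where
  "prox \<nu> h y = (ARG_MIN (\<lambda>w. h w + 1 / (2 * \<nu>) * (norm (w - y))\<^sup>2) w. True)"

definition p_obj :: "real \<Rightarrow> (real ^ 'm \<Rightarrow> real) \<Rightarrow> real ^ 'n ^ 'm \<Rightarrow> real ^ 'm \<Rightarrow> real" where
  "p_obj \<nu> h A w = h w + 1 / (2 * \<nu>) * (norm ((mat 1 - range_proj A) *v w))\<^sup>2"

end

theory Submission
  imports Defs
begin

text \<open>
  Write \<open>P = range_proj A\<close>. The argument rests on two facts.

  Strong convexity of \<open>h\<close> makes the objective of \<open>prox \<nu> h y\<close> strongly convex with parameter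
  \<open>\<alpha> + 1 / \<nu>\<close>. Such a function has a minimizer and grows quadratically away from it
  (\<open>strongly_convex_has_minimizer\<close>, \<open>strongly_convex_quadratic_growth\<close>); comparing the growth of the
  objectives at two points \<open>y\<close> and \<open>z\<close> shows that the proximal map is Lipschitz with
  constant \<open>1 / (1 + \<alpha> * \<nu>)\<close> (\<open>prox_objective_minimizers_close\<close>).

  The matrix \<open>P\<close> is symmetric and idempotent, hence nonexpansive, and by Pythagoras
  \<open>\<parallel>u - P w\<^sup>*\<parallel>\<^sup>2 = \<parallel>(I - P) u\<parallel>\<^sup>2 + \<parallel>P (u - w\<^sup>*)\<parallel>\<^sup>2\<close>. The objective of \<open>prox \<nu> h (P w\<^sup>*)\<close> therefore
  lies above \<open>p_obj\<close> and agrees with it at \<open>w\<^sup>*\<close>, so the minimizer \<open>w\<^sup>*\<close> of \<open>p_obj\<close> also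
  minimizes this objective (\<open>p_obj_minimizer_minimizes_prox_objective\<close>): it is a fixed point of
  the iteration. Each step contracts the distance to \<open>w\<^sup>*\<close> by \<open>1 / (1 + \<alpha> * \<nu>)\<close>, so the
  squared distance contracts by the square of this factor, which is at most the factor itself.

  Since the pseudo-inverse is given by a definite description, the properties of \<open>P\<close> require that
  the Penrose equations of the symmetric matrix \<open>A\<^sup>T A\<close> have exactly one solution
  (\<open>penrose_unique\<close>, \<open>penrose_exists_symmetric\<close>).
\<close>

section \<open>The pseudo-inverse of a symmetric matrix\<close>

definition penrose :: "real ^ 'n ^ 'm \<Rightarrow> real ^ 'm ^ 'n \<Rightarrow> bool" where
  "penrose M X \<longleftrightarrow> M ** X ** M = M \<and> X ** M ** X = X
     \<and> transpose (M ** X) = M ** X \<and> transpose (X ** M) = X ** M"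

text \<open>
  Both \<open>M ** X\<close> and \<open>M ** Y\<close> are orthogonal projectors onto the range of \<open>M\<close>, so they coincide;
  likewise \<open>X ** M = Y ** M\<close>. Then \<open>X = X M X = X M Y = Y M Y = Y\<close>.
\<close>
lemma penrose_unique:
  assumes X: "penrose M X" and Y: "penrose M Y"
  shows "X = Y"
proof -
  have "M ** X = transpose (M ** X)" using X by (simp add: penrose_def)
  also have "\<dots> = transpose ((M ** Y) ** (M ** X))"
    using Y by (simp add: penrose_def matrix_mul_assoc)
  also have "\<dots> = (M ** X) ** (M ** Y)"
    using X Y by (simp add: matrix_transpose_mul[of "M ** Y"] penrose_def)
  also have "\<dots> = M ** Y" using X by (simp add: penrose_def matrix_mul_assoc)
  finally have MX: "M ** X = M ** Y" .
  have "X ** M = transpose (X ** M)" using X by (simp add: penrose_def)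
  also have "\<dots> = transpose ((X ** M) ** (Y ** M))"
    using Y by (metis penrose_def matrix_mul_assoc)
  also have "\<dots> = (Y ** M) ** (X ** M)"
    using X Y by (simp add: matrix_transpose_mul[of "X ** M"] penrose_def)
  also have "\<dots> = Y ** M" using X by (metis penrose_def matrix_mul_assoc)
  finally have XM: "X ** M = Y ** M" .
  have "X = X ** (M ** X)" using X by (simp add: penrose_def matrix_mul_assoc)
  also have "\<dots> = (X ** M) ** Y" by (simp add: MX matrix_mul_assoc)
  also have "\<dots> = Y" using Y by (simp add: XM penrose_def)
  finally show ?thesis .
qed

lemma symmetric_matrix_inner:
  fixes B :: "real ^ 'n ^ 'n"
  assumes "transpose B = B"
  shows "(B *v x) \<bullet> y = x \<bullet> (B *v y)"
proof -
  have "(transpose B *v x) \<bullet> y = x \<bullet> (B *v y)" by (simp add: dot_lmul_matrix)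
  then show ?thesis by (simp only: assms)
qed

text \<open>
  A symmetric \<open>M\<close> is injective on its range \<open>S\<close>, because \<open>M (M x) = 0\<close> gives
  \<open>\<parallel>M x\<parallel>\<^sup>2 = M (M x) \<bullet> x = 0\<close>; by dimension \<open>M\<close> maps \<open>S\<close> onto \<open>S\<close>. Let \<open>g\<close> be a linear map
  into \<open>S\<close> that inverts \<open>M\<close> on \<open>S\<close>. Then \<open>g \<circ> M\<close> is the orthogonal projector onto \<open>S\<close>, and
  \<open>g \<circ> g \<circ> M\<close>, which projects first and then inverts on \<open>S\<close>, is the pseudo-inverse.
\<close>
lemma penrose_exists_symmetric:
  fixes M :: "real ^ 'n ^ 'n"
  assumes sym: "transpose M = M"
  shows "\<exists>X. penrose M X"
proof -
  define f where "f = (\<lambda>x. M *v x)"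
  define S where "S = range f"
  have lf: "linear f" by (simp add: f_def)
  have f_adj: "f x \<bullet> y = x \<bullet> f y" for x y
    unfolding f_def by (rule symmetric_matrix_inner[OF sym])
  have subS: "subspace S" unfolding S_def by (simp add: lf linear_subspace_image)
  have fS: "f x \<in> S" for x by (simp add: S_def)
  have ker: "f x = 0" if "f (f x) = 0" for x
    using f_adj[of "f x" x] that by simp
  have inj: "inj_on f S"
    unfolding linear_inj_on_iff_eq_0[OF lf subS] using ker by (auto simp: S_def)
  have "f ` S = S"
  proof (rule subspace_dim_equal)
    show "subspace (f ` S)" by (simp add: lf subS linear_subspace_image)
    show "dim S \<le> dim (f ` S)"
      using dim_image_eq[OF lf, of S] inj subS by (simp add: span_eq_iff[THEN iffD2])
  qed (use fS subS in auto)
  moreover obtain g where g: "range g \<subseteq> S" "linear g" "\<And>v. v \<in> S \<Longrightarrow> g (f v) = v"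
    using linear_exists_left_inverse_on[OF lf subS inj] by auto
  ultimately have fg: "f (g s) = s" if "s \<in> S" for s using that by (metis imageE)
  have gS: "g x \<in> S" for x using g(1) by auto
  have proj_adj: "g (f x) \<bullet> y = x \<bullet> g (f y)" for x y
  proof -
    \<comment> \<open>The residual of \<open>g \<circ> f\<close> lies in the kernel of \<open>f\<close>, which is orthogonal to \<open>S\<close>.\<close>
    have orth: "g u \<bullet> (v - g (f v)) = 0" for u v
    proof -
      obtain z where z: "g u = f z" using gS[of u] by (auto simp: S_def)
      have "f (v - g (f v)) = 0" by (simp add: linear_diff[OF lf] fg fS)
      then show ?thesis by (simp add: z f_adj)
    qed
    show ?thesis using orth[of "f x" y] orth[of "f y" x]
      by (simp add: inner_diff_right inner_commute)
  qed
  define X where "X = matrix (\<lambda>x. g (g (f x)))"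
  have "linear (\<lambda>x. g (g (f x)))"
    using linear_compose[OF linear_compose[OF lf g(2)] g(2)] by (simp add: o_def)
  then have Xv: "X *v x = g (g (f x))" for x by (simp add: X_def)
  have Mv: "M *v x = f x" for x by (simp add: f_def)
  have symI: "transpose B = B" if "\<And>x y. (B *v x) \<bullet> y = x \<bullet> (B *v y)" for B :: "real ^ 'n ^ 'n"
  proof -
    have "(transpose B *v x) \<bullet> y = (B *v x) \<bullet> y" for x y
      by (simp add: that dot_lmul_matrix)
    then show ?thesis unfolding matrix_eq using vector_eq_rdot by blast
  qed
  have MX: "(M ** X) *v x = g (f x)" and XM: "(X ** M) *v x = g (f x)" for x
    by (simp_all add: Mv Xv fg gS g(3) fS flip: matrix_vector_mul_assoc)
  have "M ** X ** M = M" "X ** M ** X = X"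
    unfolding matrix_eq
    by (simp_all add: Mv Xv g(3) gS fg fS flip: matrix_vector_mul_assoc)
  moreover have "transpose (M ** X) = M ** X" "transpose (X ** M) = X ** M"
    by (rule symI; simp only: MX XM proj_adj)+
  ultimately show ?thesis unfolding penrose_def by blast
qed

lemma penrose_pinv_symmetric:
  fixes M :: "real ^ 'n ^ 'n"
  assumes "transpose M = M"
  shows "penrose M (pinv M)"
proof -
  have "\<exists>!X. penrose M X"
    using penrose_exists_symmetric[OF assms] penrose_unique by blast
  then have "penrose M (THE X. penrose M X)" by (rule theI')
  then show ?thesis by (simp add: pinv_def penrose_def)
qed

text \<open>
  Transposition preserves the Penrose equations of a symmetric matrix, so uniqueness applies.
\<close>
lemma transpose_pinv_symmetric:
  fixes M :: "real ^ 'n ^ 'n"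
  assumes sym: "transpose M = M"
  shows "transpose (pinv M) = pinv M"
proof (rule penrose_unique)
  let ?X = "pinv M"
  let ?Y = "transpose ?X"
  show X: "penrose M ?X" by (rule penrose_pinv_symmetric[OF sym])
  have MY: "M ** ?Y = transpose (?X ** M)" and YM: "?Y ** M = transpose (M ** ?X)"
    by (simp_all add: matrix_transpose_mul sym)
  have "M ** ?Y ** M = transpose (M ** ?X ** M)" "?Y ** M ** ?Y = transpose (?X ** M ** ?X)"
    by (simp_all add: matrix_transpose_mul matrix_mul_assoc sym)
  then have "M ** ?Y ** M = M" "?Y ** M ** ?Y = ?Y" using X by (simp_all add: penrose_def sym)
  moreover have "transpose (M ** ?Y) = M ** ?Y" "transpose (?Y ** M) = ?Y ** M"
    unfolding MY YM using X by (simp_all add: penrose_def)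
  ultimately show "penrose M ?Y" unfolding penrose_def by blast
qed

section \<open>The range projector\<close>

lemma range_proj_idempotent: "range_proj A ** range_proj A = range_proj A"
proof -
  let ?M = "transpose A ** A"
  have "penrose ?M (pinv ?M)"
    by (rule penrose_pinv_symmetric) (simp add: matrix_transpose_mul)
  then have "pinv ?M ** ?M ** pinv ?M = pinv ?M" by (simp add: penrose_def)
  moreover have "range_proj A ** range_proj A
      = A ** (pinv ?M ** ?M ** pinv ?M) ** transpose A"
    by (simp add: range_proj_def matrix_mul_assoc)
  ultimately show ?thesis by (simp only: range_proj_def)
qed

lemma range_proj_symmetric: "transpose (range_proj A) = range_proj A"
proof -
  have "transpose (pinv (transpose A ** A)) = pinv (transpose A ** A)"
    by (rule transpose_pinv_symmetric) (simp add: matrix_transpose_mul)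
  then show ?thesis
    by (simp add: range_proj_def matrix_transpose_mul matrix_mul_assoc)
qed

lemma range_proj_pythagoras:
  fixes u v :: "real ^ 'm"
  shows "(norm (u - range_proj A *v v))\<^sup>2
    = (norm ((mat 1 - range_proj A) *v u))\<^sup>2 + (norm (range_proj A *v (u - v)))\<^sup>2"
proof -
  let ?P = "range_proj A"
  have "?P *v (u - ?P *v u) = 0"
    by (simp add: matrix_vector_mult_diff_distrib matrix_vector_mul_assoc range_proj_idempotent)
  moreover have "(u - ?P *v u) \<bullet> (?P *v (u - v)) = (?P *v (u - ?P *v u)) \<bullet> (u - v)"
    by (rule symmetric_matrix_inner[OF range_proj_symmetric, symmetric])
  ultimately have "orthogonal (u - ?P *v u) (?P *v (u - v))"
    by (simp add: orthogonal_def)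
  moreover have "u - ?P *v v = (u - ?P *v u) + ?P *v (u - v)"
    by (simp add: matrix_vector_mult_diff_distrib)
  moreover have "(mat 1 - ?P) *v u = u - ?P *v u"
    by (simp add: matrix_vector_mult_diff_rdistrib)
  ultimately show ?thesis by (simp only: norm_add_Pythagorean)
qed

lemma range_proj_nonexpansive: "norm (range_proj A *v x) \<le> norm x"
proof (rule power2_le_imp_le)
  show "(norm (range_proj A *v x))\<^sup>2 \<le> (norm x)\<^sup>2"
    using range_proj_pythagoras[of x A 0] by simp
qed simp

section \<open>Minimizers of strongly convex functions\<close>

text \<open>
  Convexity of \<open>h - \<alpha>/2 \<parallel>\<cdot>\<parallel>\<^sup>2\<close> turns into a gain over the chord because the squared norm satisfies
  \<open>s \<parallel>x\<parallel>\<^sup>2 + t \<parallel>y\<parallel>\<^sup>2 - \<parallel>s x + t y\<parallel>\<^sup>2 = s t \<parallel>x - y\<parallel>\<^sup>2\<close> when \<open>s + t = 1\<close>.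
\<close>
lemma strongly_convex_ineq:
  fixes f :: "'a::real_inner \<Rightarrow> real"
  assumes "strongly_convex \<mu> f" "0 \<le> t" "t \<le> 1"
  shows "f ((1 - t) *\<^sub>R x + t *\<^sub>R y)
    \<le> (1 - t) * f x + t * f y - \<mu> / 2 * (t * (1 - t) * (norm (x - y))\<^sup>2)"
proof -
  have conv: "f ((1 - t) *\<^sub>R x + t *\<^sub>R y) - \<mu> / 2 * (norm ((1 - t) *\<^sub>R x + t *\<^sub>R y))\<^sup>2
     \<le> (1 - t) * (f x - \<mu> / 2 * (norm x)\<^sup>2) + t * (f y - \<mu> / 2 * (norm y)\<^sup>2)"
    by (rule convex_onD[OF assms(1)[unfolded strongly_convex_def] assms(2,3)]) simp_all
  have sq: "(norm ((1 - t) *\<^sub>R x + t *\<^sub>R y))\<^sup>2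
      = (1 - t) * (norm x)\<^sup>2 + t * (norm y)\<^sup>2 - t * (1 - t) * (norm (x - y))\<^sup>2"
    unfolding power2_norm_eq_inner
    by (simp add: inner_add_left inner_add_right inner_diff_left inner_diff_right
        inner_commute[of y x] algebra_simps)
  show ?thesis using conv unfolding sq
    by (simp add: algebra_simps add_divide_distrib diff_divide_distrib)
qed

text \<open>
  Minimality of \<open>x\<close> against the points \<open>(1 - t) x + t y\<close> leaves \<open>\<mu>/2 (1 - t) \<parallel>x - y\<parallel>\<^sup>2 \<le> f y - f x\<close>
  for \<open>t > 0\<close>; let \<open>t\<close> tend to \<open>0\<close>.
\<close>
lemma strongly_convex_quadratic_growth:
  fixes f :: "'a::real_inner \<Rightarrow> real"
  assumes sc: "strongly_convex \<mu> f" and min: "\<And>y. f x \<le> f y"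
  shows "f x + \<mu> / 2 * (norm (x - y))\<^sup>2 \<le> f y"
proof -
  let ?c = "\<mu> / 2 * (norm (x - y))\<^sup>2"
  have le: "(1 - t) * ?c \<le> f y - f x" if "0 < t" "t < 1" for t
  proof -
    have "f x \<le> (1 - t) * f x + t * f y - \<mu> / 2 * (t * (1 - t) * (norm (x - y))\<^sup>2)"
      using strongly_convex_ineq[OF sc, of t x y] min[of "(1 - t) *\<^sub>R x + t *\<^sub>R y"] that by simp
    then have "t * ((1 - t) * ?c) \<le> t * (f y - f x)"
      by (simp add: algebra_simps diff_divide_distrib)
    then show ?thesis using that by simp
  qed
  have "((\<lambda>t. (1 - t) * ?c) \<longlongrightarrow> (1 - 0) * ?c) (at_right 0)"
    by (intro tendsto_intros)
  moreover have "\<forall>\<^sub>F t in at_right 0. (1 - t) * ?c \<le> f y - f x"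
    using le by (auto simp: eventually_at_right_field intro!: exI[of _ 1])
  ultimately have "(1 - 0) * ?c \<le> f y - f x"
    by (intro tendsto_upperbound[where F = "at_right 0"]) auto
  then show ?thesis by simp
qed

lemma strongly_convex_continuous:
  fixes f :: "'a::euclidean_space \<Rightarrow> real"
  assumes "strongly_convex \<mu> f"
  shows "continuous_on UNIV f"
proof -
  have "continuous_on UNIV (\<lambda>w. f w - \<mu> / 2 * (norm w)\<^sup>2)"
    using assms by (intro convex_on_continuous) (auto simp: strongly_convex_def)
  then have "continuous_on UNIV (\<lambda>w. (f w - \<mu> / 2 * (norm w)\<^sup>2) + \<mu> / 2 * (norm w)\<^sup>2)"
    by (rule continuous_on_add) (intro continuous_intros)
  then show ?thesis by simp
qed

text \<open>
  Strong convexity along the ray through \<open>u\<close> bounds \<open>f u\<close> from below by a quadratic in \<open>\<parallel>u\<parallel>\<close> whose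
  coefficients depend only on \<open>\<mu>\<close>, \<open>f 0\<close> and the minimum of \<open>f\<close> on the unit ball. So \<open>f\<close> exceeds \<open>f 0\<close>
  outside a large ball, and its minimum over that compact ball is global.
\<close>
lemma strongly_convex_has_minimizer:
  fixes f :: "'a::euclidean_space \<Rightarrow> real"
  assumes sc: "strongly_convex \<mu> f" and "\<mu> > 0"
  shows "\<exists>x. \<forall>y. f x \<le> f y"
proof -
  have cont: "continuous_on B f" for B
    using strongly_convex_continuous[OF sc] continuous_on_subset by blast
  have "\<exists>z\<in>cball 0 1. \<forall>y\<in>cball 0 1. f z \<le> f y"
    using continuous_attains_inf[of "cball (0::'a) 1" f] cont by simp
  then obtain z where "\<forall>y\<in>cball 0 1. f z \<le> f y" by blast
  then have z: "f z \<le> f y" if "norm y \<le> 1" for y using that by simp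
  \<comment> \<open>\<open>R\<close> is the radius at which the quadratic lower bound reaches \<open>f 0\<close>.\<close>
  define R where "R = 1 + 2 * (f 0 - f z) / \<mu>"
  have R1: "R \<ge> 1" using z[of 0] \<open>\<mu> > 0\<close> by (simp add: R_def)
  have far: "f 0 \<le> f u" if "norm u \<ge> R" for u
  proof -
    let ?n = "norm u"
    have n: "?n \<ge> 1" using that R1 by simp
    define t where "t = 1 / ?n"
    have t: "0 < t" "t \<le> 1" "t * ?n = 1" using n by (auto simp: t_def divide_le_eq)
    have "norm (t *\<^sub>R u) \<le> 1" using t by simp
    then have "f z \<le> (1 - t) * f 0 + t * f u - \<mu> / 2 * (t * (1 - t) * ?n\<^sup>2)"
      using z[of "t *\<^sub>R u"] strongly_convex_ineq[OF sc, of t 0 u] t by simp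
    moreover have "t * (1 - t) * ?n\<^sup>2 = ?n - 1"
      using t(3) by algebra
    ultimately have "f z \<le> (1 - t) * f 0 + t * f u - \<mu> / 2 * (?n - 1)" by (simp only:)
    moreover have "f 0 - f z \<le> \<mu> / 2 * (?n - 1)"
      using that \<open>\<mu> > 0\<close> by (simp add: R_def field_simps)
    ultimately have "t * f 0 \<le> t * f u"
      by (simp add: algebra_simps diff_divide_distrib)
    then show ?thesis using t(1) by simp
  qed
  have "\<exists>x\<in>cball 0 R. \<forall>y\<in>cball 0 R. f x \<le> f y"
    using continuous_attains_inf[of "cball (0::'a) R" f] cont R1 by simp
  then obtain x where "\<forall>y\<in>cball 0 R. f x \<le> f y" by blast
  then have x: "f x \<le> f y" if "norm y \<le> R" for y using that by simp
  have "f x \<le> f y" for y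
    using x[of y] x[of 0] far[of y] R1 by (cases "norm y \<le> R") auto
  then show ?thesis by blast
qed

section \<open>The proximal map\<close>

definition prox_objective :: "real \<Rightarrow> ('a::real_normed_vector \<Rightarrow> real) \<Rightarrow> 'a \<Rightarrow> 'a \<Rightarrow> real" where
  "prox_objective \<nu> h y w = h w + 1 / (2 * \<nu>) * (norm (w - y))\<^sup>2"

text \<open>
  Up to the term \<open>1/(2\<nu>) \<parallel>w\<parallel>\<^sup>2\<close>, the quadratic penalty is affine in \<open>w\<close>, so it raises the
  parameter of strong convexity by exactly \<open>1 / \<nu>\<close>.
\<close>
lemma strongly_convex_prox_objective:
  fixes h :: "'a::real_inner \<Rightarrow> real"
  assumes "strongly_convex \<alpha> h"
  shows "strongly_convex (\<alpha> + 1 / \<nu>) (prox_objective \<nu> h y)"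
proof -
  let ?a = "\<lambda>w. (1 / (2 * \<nu>)) * ((norm y)\<^sup>2 - 2 * (w \<bullet> y))"
  have "convex_on UNIV ?a"
  proof (rule convex_onI)
    fix t :: real and u v :: 'a
    show "?a ((1 - t) *\<^sub>R u + t *\<^sub>R v) \<le> (1 - t) * ?a u + t * ?a v"
      by (simp add: algebra_simps add_divide_distrib diff_divide_distrib)
  qed simp
  then have "convex_on UNIV (\<lambda>w. (h w - \<alpha> / 2 * (norm w)\<^sup>2) + ?a w)"
    using assms by (intro convex_on_add) (auto simp: strongly_convex_def)
  moreover have "prox_objective \<nu> h y w - (\<alpha> + 1 / \<nu>) / 2 * (norm w)\<^sup>2
      = (h w - \<alpha> / 2 * (norm w)\<^sup>2) + ?a w" for w
    unfolding prox_objective_def power2_norm_eq_inner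
    by (simp add: inner_diff_left inner_diff_right inner_commute[of y w] algebra_simps
        add_divide_distrib diff_divide_distrib)
  ultimately show ?thesis unfolding strongly_convex_def by simp
qed

lemma prox_minimizes:
  fixes h :: "'a::euclidean_space \<Rightarrow> real"
  assumes "strongly_convex \<alpha> h" "\<alpha> > 0" "\<nu> > 0"
  shows "prox_objective \<nu> h y (prox \<nu> h y) \<le> prox_objective \<nu> h y u"
proof -
  let ?F = "prox_objective \<nu> h y"
  have "\<alpha> + 1 / \<nu> > 0" using assms by (simp add: add_pos_pos)
  then obtain x where "\<And>u. ?F x \<le> ?F u"
    using strongly_convex_has_minimizer[OF strongly_convex_prox_objective[OF assms(1)]] by blast
  then have "is_arg_min ?F (\<lambda>_. True) x" by (simp add: is_arg_min_linorder)
  then have "is_arg_min ?F (\<lambda>_. True) (arg_min ?F (\<lambda>_. True))"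
    unfolding arg_min_def by (rule someI)
  moreover have "prox \<nu> h y = arg_min ?F (\<lambda>_. True)"
    by (simp add: prox_def prox_objective_def[abs_def])
  ultimately show ?thesis by (simp add: is_arg_min_linorder)
qed

text \<open>
  Adding the quadratic growth inequalities of the two objectives cancels \<open>h\<close> and leaves
  \<open>(1 + \<alpha> \<nu>) \<parallel>u - v\<parallel>\<^sup>2 \<le> (u - v) \<bullet> (y - z)\<close>; Cauchy-Schwarz finishes. Stated for
  minimizers instead of values of \<open>prox\<close>, it applies directly to a point that is only known to
  minimize the objective; the case \<open>y = z\<close> shows that minimizers are unique.
\<close>
lemma prox_objective_minimizers_close:
  fixes h :: "'a::real_inner \<Rightarrow> real"
  assumes h: "strongly_convex \<alpha> h" and "\<alpha> > 0" "\<nu> > 0"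
    and u: "\<And>x. prox_objective \<nu> h y u \<le> prox_objective \<nu> h y x"
    and v: "\<And>x. prox_objective \<nu> h z v \<le> prox_objective \<nu> h z x"
  shows "(1 + \<alpha> * \<nu>) * norm (u - v) \<le> norm (y - z)"
proof -
  let ?d = "(norm (u - v))\<^sup>2"
  define r where "r = 1 / (2 * \<nu>)"
  have r: "1 / \<nu> = 2 * r" by (simp add: r_def)
  have "(\<alpha> + 1 / \<nu>) * ?d
      \<le> r * ((norm (v - y))\<^sup>2 - (norm (u - y))\<^sup>2 + (norm (u - z))\<^sup>2 - (norm (v - z))\<^sup>2)"
    using strongly_convex_quadratic_growth[OF strongly_convex_prox_objective[OF h] u, of v]
      strongly_convex_quadratic_growth[OF strongly_convex_prox_objective[OF h] v, of u]
    unfolding prox_objective_def norm_minus_commute[of v u] r r_def[symmetric]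
    by (simp add: algebra_simps add_divide_distrib)
  also have "(norm (v - y))\<^sup>2 - (norm (u - y))\<^sup>2 + (norm (u - z))\<^sup>2 - (norm (v - z))\<^sup>2
      = 2 * ((u - v) \<bullet> (y - z))"
    unfolding power2_norm_eq_inner
    by (simp add: inner_diff_left inner_diff_right inner_commute algebra_simps)
  finally have "\<nu> * ((\<alpha> + 1 / \<nu>) * ?d) \<le> \<nu> * (r * (2 * ((u - v) \<bullet> (y - z))))"
    using \<open>\<nu> > 0\<close> by (intro mult_left_mono) simp_all
  moreover have "\<nu> * ((\<alpha> + 1 / \<nu>) * ?d) = (1 + \<alpha> * \<nu>) * ?d"
    using \<open>\<nu> > 0\<close> by (simp add: field_simps)
  moreover have "\<nu> * (r * (2 * ((u - v) \<bullet> (y - z)))) = (u - v) \<bullet> (y - z)"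
    using \<open>\<nu> > 0\<close> by (simp add: r_def)
  ultimately have "(1 + \<alpha> * \<nu>) * ?d \<le> (u - v) \<bullet> (y - z)" by simp
  also have "\<dots> \<le> norm (u - v) * norm (y - z)" by (rule norm_cauchy_schwarz)
  finally have "norm (u - v) * ((1 + \<alpha> * \<nu>) * norm (u - v)) \<le> norm (u - v) * norm (y - z)"
    by (simp add: power2_eq_square algebra_simps)
  then show ?thesis by (cases "u = v") auto
qed

text \<open>
  By \<open>range_proj_pythagoras\<close> the objective of \<open>prox \<nu> h (P w\<^sup>*)\<close> majorizes \<open>p_obj\<close>, with equality at \<open>w\<^sup>*\<close>.
\<close>
lemma p_obj_minimizer_minimizes_prox_objective:
  assumes "\<nu> > 0" and min: "is_arg_min (p_obj \<nu> h A) (\<lambda>_. True) w"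
  shows "prox_objective \<nu> h (range_proj A *v w) w \<le> prox_objective \<nu> h (range_proj A *v w) x"
proof -
  have eq: "prox_objective \<nu> h (range_proj A *v w) u
      = p_obj \<nu> h A u + 1 / (2 * \<nu>) * (norm (range_proj A *v (u - w)))\<^sup>2" for u
    unfolding prox_objective_def p_obj_def range_proj_pythagoras by (simp add: distrib_left)
  have "p_obj \<nu> h A w \<le> p_obj \<nu> h A x"
    using min by (simp add: is_arg_min_linorder)
  then show ?thesis using \<open>\<nu> > 0\<close> by (simp add: eq add_increasing2)
qed

section \<open>Linear convergence of the proximal gradient iteration\<close>

theorem theorem7:
  fixes A :: "real ^ 'n ^ 'm"
    and h :: "real ^ 'm \<Rightarrow> real"
    and h_comp :: "'m \<Rightarrow> real \<Rightarrow> real"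
    and \<nu> \<alpha> :: real
    and w_star w0 :: "real ^ 'm"
    and w :: "nat \<Rightarrow> real ^ 'm"
  assumes "\<nu> > 0"
    and "\<alpha> > 0"
    and closed_h: "closed (epigraph UNIV h)"
    and separable_h: "\<And>v. h v = (\<Sum>i\<in>UNIV. h_comp i (v $ i))"
    and "strongly_convex \<alpha> h"
    and w_star: "is_arg_min (p_obj \<nu> h A) (\<lambda>_. True) w_star"
    and w_0: "w 0 = w0"
    and w_Suc: "\<And>k. w (Suc k) = prox \<nu> h (range_proj A *v w k)"
  shows "\<forall>k. (norm (w (Suc k) - w_star))\<^sup>2 \<le> 1 / (1 + \<alpha> * \<nu>) * (norm (w k - w_star))\<^sup>2"
proof
  fix k
  let ?d = "norm (w (Suc k) - w_star)" and ?e = "norm (w k - w_star)" and ?c = "1 + \<alpha> * \<nu>"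
  have c: "?c \<ge> 1" using assms(1,2) by simp
  have "?c * ?d \<le> norm (range_proj A *v w k - range_proj A *v w_star)"
    unfolding w_Suc
    using prox_objective_minimizers_close[OF assms(5,2,1) prox_minimizes[OF assms(5,2,1)]
        p_obj_minimizer_minimizes_prox_objective[OF assms(1) w_star]] .
  also have "\<dots> \<le> ?e"
    using range_proj_nonexpansive[of A "w k - w_star"]
    by (simp add: matrix_vector_mult_diff_distrib)
  finally have contr: "?c * ?d \<le> ?e" .
  have "?c * ?d\<^sup>2 \<le> ?c * (?c * ?d\<^sup>2)"
    using mult_right_mono[OF c, of "?c * ?d\<^sup>2"] c by simp
  also have "\<dots> = (?c * ?d)\<^sup>2" by (simp add: power2_eq_square)
  also have "\<dots> \<le> ?e\<^sup>2" using contr c by (intro power_mono) auto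
  finally show "?d\<^sup>2 \<le> 1 / ?c * ?e\<^sup>2" using c by (simp add: field_simps)
qed

end
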